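(* For every positive integer $k$, $N_2(k)\le 2k+2$.
   Context: A nice measure on $\mathbb{R}^d$ is a finite nonzero Borel measure that has a continuous, everywhere strictly positive density with respect to Lebesgue measure. A convex partition of $\mathbb{R}^d$ into $n$ parts is a covering of $\mathbb{R}^d$ by $n$ closed convex sets (possibly unbounded, with nonempty interior) whose interiors are pairwise disjoint. An (affine) hyperplane avoids a set $C$ if it does not intersect the interior of $C$. $N_d(k)$ denotes the smallest positive integer $n$ such that for every nice measure $\mu$ on $\mathbb{R}^d$ there exists a convex partition of $\mathbb{R}^d$ into $n$ parts of equal $\mu$-measure such that every hyperplane avoids at least $k$ of the parts. *)

theory Defs
  imports "HOL-Analysis.Analysis" "HOL-Library.Extended_Nat"
begin

definition nice_measure :: "(real ^ 'd) measure \<Rightarrow> bool" where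
  "nice_measure \<mu> \<longleftrightarrow>
     sets \<mu> = sets borel \<and> finite_measure \<mu> \<and> emeasure \<mu> (space \<mu>) \<noteq> 0 \<and>
     (\<exists>f. continuous_on UNIV f \<and> (\<forall>x. f x > 0) \<and>
          \<mu> = density lborel (\<lambda>x. ennreal (f x)))"

definition convex_partition :: "nat \<Rightarrow> (real ^ 'd) set set \<Rightarrow> bool" where
  "convex_partition n P \<longleftrightarrow>
     finite P \<and> card P = n \<and> \<Union>P = UNIV \<and>
     (\<forall>C\<in>P. closed C \<and> convex C \<and> interior C \<noteq> {}) \<and>
     (\<forall>C\<in>P. \<forall>D\<in>P. C \<noteq> D \<longrightarrow> interior C \<inter> interior D = {})"

definition hyperplane :: "(real ^ 'd) set \<Rightarrow> bool" where
  "hyperplane H \<longleftrightarrow> (\<exists>a b. a \<noteq> 0 \<and> H = {x. a \<bullet> x = b})"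

definition avoids :: "(real ^ 'd) set \<Rightarrow> (real ^ 'd) set \<Rightarrow> bool" where
  "avoids H C \<longleftrightarrow> H \<inter> interior C = {}"

(* The dimension d of the ambient space is CARD('d).  The minimum is taken in enat, so that it is
   \<infinity> when no n is admissible; a finite upper bound thus entails that an admissible n exists. *)
definition N_parts :: "'d::finite itself \<Rightarrow> nat \<Rightarrow> enat" where
  "N_parts _ k = Inf (enat ` {n. n > 0 \<and>
     (\<forall>\<mu> :: (real ^ 'd) measure. nice_measure \<mu> \<longrightarrow>
        (\<exists>P. convex_partition n P \<and>
             (\<forall>C\<in>P. \<forall>D\<in>P. emeasure \<mu> C = emeasure \<mu> D) \<and>
             (\<forall>H. hyperplane H \<longrightarrow> k \<le> card {C \<in> P. avoids H C})))})"

end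

theory Submission
  imports Defs
begin

text \<open>
  For a nice measure of the plane, a partition into \<open>2 * k + 2\<close> parts of equal measure \<open>c\<close> is built
  such that every line meets the interiors of at most \<open>k + 2\<close> of them. The parts arise from
  \<open>k + 1\<close> straight cuts: the first is a line, each later one is a chord that crosses exactly two
  existing parts, adjacent along an earlier cut, and so creates two new parts. A line crosses each cut
  at most once, hence meets at most \<open>(k + 1) + 1\<close> parts.

  The first line splits the plane into open half-planes \<open>A\<close> and \<open>B\<close> of measures \<open>2 * c\<close> and
  \<open>2 * k * c\<close>. Given separated convex sets \<open>A\<close> and \<open>B\<close> of measures \<open>2 * c\<close> and \<open>2 * i * c\<close>, one
  line divides \<open>A\<close> into two final parts of measure \<open>c\<close> and \<open>B\<close> into pieces of measures \<open>2 * c\<close> and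
  \<open>2 * (i - 1) * c\<close>, and the construction goes on with these two pieces of \<open>B\<close>; when \<open>i = 1\<close>, the
  pieces of \<open>B\<close> have measure \<open>c\<close> each and the construction ends. This is
  \<open>separated_pair_partition\<close>.

  Such simultaneous cuts exist by \<open>separated_ham_sandwich\<close>: for each direction there is a unique
  hyperplane cutting off the prescribed part of \<open>A\<close>, it depends continuously on the direction, and as
  the direction runs through the connected unit sphere, the part of \<open>B\<close> cut off takes all values
  between \<open>0\<close> and the measure of \<open>B\<close>, since both extremes occur at the two normals of a hyperplane
  separating \<open>A\<close> from \<open>B\<close>.

  Throughout, the parts are open sets. The closures are taken only at the end, in
  \<open>nice_measure_partition_closures\<close>; they cover the plane because the measures of the parts add up to
  the total measure.
\<close>

section \<open>Nice measures and half-spaces\<close>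

lemma
  assumes "nice_measure \<mu>"
  shows sets_nice_measure: "sets \<mu> = sets borel"
    and finite_nice_measure: "finite_measure \<mu>"
  using assms by (auto simp: nice_measure_def)

text \<open>The density being positive, the null sets are those of Lebesgue measure.\<close>

lemma nice_measure_null_sets:
  fixes \<mu> :: "(real ^ 'd) measure"
  assumes "nice_measure \<mu>" "S \<in> sets borel"
  shows "S \<in> null_sets \<mu> \<longleftrightarrow> negligible S"
proof -
  obtain f where f: "continuous_on UNIV f" "\<And>x. f x > (0::real)"
      "\<mu> = density lborel (\<lambda>x. ennreal (f x))"
    using assms(1) unfolding nice_measure_def by blast
  have m: "(\<lambda>x. ennreal (f x)) \<in> borel_measurable lborel"
    using borel_measurable_continuous_onI[OF f(1)] by simp
  have "S \<in> null_sets \<mu> \<longleftrightarrow> S \<in> sets lborel \<and> (AE x in lborel. x \<in> S \<longrightarrow> ennreal (f x) = 0)"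
    unfolding f(3) by (rule null_sets_density_iff[OF m])
  also have "\<dots> \<longleftrightarrow> S \<in> sets lborel \<and> (AE x in lborel. x \<notin> S)"
  proof -
    have "ennreal (f x) \<noteq> 0" for x using f(2)[of x] by (simp add: ennreal_eq_0_iff)
    then show ?thesis by simp
  qed
  also have "\<dots> \<longleftrightarrow> S \<in> null_sets lborel"
    using AE_iff_null_sets[of S lborel] assms(2) by auto
  also have "\<dots> \<longleftrightarrow> negligible S"
    using assms(2) by (simp add: negligible_iff_null_sets null_sets_completion_iff)
  finally show ?thesis .
qed

lemma nice_measure_open_pos:
  fixes \<mu> :: "(real ^ 'd) measure"
  assumes \<mu>: "nice_measure \<mu>" and "open S" "S \<noteq> {}"
  shows "measure \<mu> S > 0"
proof -
  interpret finite_measure \<mu> using \<mu> by (rule finite_nice_measure)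
  have S: "S \<in> sets \<mu>" using assms by (simp add: sets_nice_measure)
  have "\<not> negligible S" using assms open_not_negligible by blast
  moreover have "S \<in> sets borel" using \<open>open S\<close> by simp
  ultimately have "S \<notin> null_sets \<mu>" by (simp add: nice_measure_null_sets[OF \<mu>])
  then have "emeasure \<mu> S \<noteq> 0" using S by (simp add: null_sets_def)
  then have "measure \<mu> S \<noteq> 0" by (simp add: emeasure_eq_measure)
  then show ?thesis using measure_nonneg[of \<mu> S] by linarith
qed

text \<open>The open half-space below the hyperplane with normal \<open>u\<close> and offset \<open>t\<close>. The vector \<open>u\<close> is
  not required to be nonzero or normalised, and \<open>u\<close> and \<open>-u\<close> give the two orientations.\<close>

definition lower_halfspace :: "'a::real_inner \<Rightarrow> real \<Rightarrow> 'a set" where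
  "lower_halfspace u t = {x. u \<bullet> x < t}"

lemma lower_halfspace_simps:
  "x \<in> lower_halfspace u t \<longleftrightarrow> u \<bullet> x < t"
  by (simp add: lower_halfspace_def)

lemma open_lower_halfspace: "open (lower_halfspace u t)"
  by (simp add: lower_halfspace_def open_halfspace_lt)

lemma convex_lower_halfspace: "convex (lower_halfspace u t)"
  by (simp add: lower_halfspace_def convex_halfspace_lt)

text \<open>Joint continuity in normal and offset: away from the limiting hyperplane, which is a null set,
  the indicator functions converge pointwise.\<close>

lemma tendsto_measure_lower_halfspace:
  fixes \<mu> :: "(real ^ 'd) measure"
  assumes \<mu>: "nice_measure \<mu>" and S: "S \<in> sets borel" and "u \<noteq> 0"
    and lim: "U \<longlonglongrightarrow> u" "T \<longlonglongrightarrow> t"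
  shows "(\<lambda>n. measure \<mu> (S \<inter> lower_halfspace (U n) (T n))) \<longlonglongrightarrow> measure \<mu> (S \<inter> lower_halfspace u t)"
proof -
  interpret finite_measure \<mu> using \<mu> by (rule finite_nice_measure)
  have sets: "sets \<mu> = sets borel" using \<mu> by (rule sets_nice_measure)
  let ?I = "\<lambda>u t. indicat_real (S \<inter> lower_halfspace u t)"
  have meas: "S \<inter> lower_halfspace u t \<in> sets \<mu>" for u t
    using S by (simp add: sets borel_open open_lower_halfspace)
  have null: "{x. u \<bullet> x = t} \<in> null_sets \<mu>"
    using nice_measure_null_sets[OF \<mu>] negligible_hyperplane[of u t] \<open>u \<noteq> 0\<close>
    by (simp add: borel_closed closed_hyperplane)
  have "(\<lambda>n. \<integral>x. ?I (U n) (T n) x \<partial>\<mu>) \<longlonglongrightarrow> (\<integral>x. ?I u t x \<partial>\<mu>)"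
  proof (rule integral_dominated_convergence[where w = "\<lambda>_. 1"])
    have "(\<lambda>n. ?I (U n) (T n) x) \<longlonglongrightarrow> ?I u t x" if "x \<notin> {x. u \<bullet> x = t}" for x
    proof -
      have l: "(\<lambda>n. U n \<bullet> x - T n) \<longlonglongrightarrow> u \<bullet> x - t"
        by (intro tendsto_intros lim)
      have "\<forall>\<^sub>F n in sequentially. (U n \<bullet> x < T n) = (u \<bullet> x < t)"
      proof (cases "u \<bullet> x < t")
        case True
        then show ?thesis
          using order_tendstoD(2)[OF l, of 0] by (auto elim: eventually_mono)
      next
        case False
        with that have "u \<bullet> x - t > 0" by auto
        then show ?thesis
          using order_tendstoD(1)[OF l, of 0] by (auto elim!: eventually_mono)
      qed
      then have "\<forall>\<^sub>F n in sequentially. ?I (U n) (T n) x = ?I u t x"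
        by (rule eventually_mono) (auto simp: lower_halfspace_simps indicator_def)
      then show ?thesis by (rule tendsto_eventually)
    qed
    then show "AE x in \<mu>. (\<lambda>n. ?I (U n) (T n) x) \<longlonglongrightarrow> ?I u t x"
      by (intro AE_I'[OF null]) auto
  qed (auto simp: meas indicator_le_1 simp del: indicator_inter_arith intro!: borel_measurable_indicator)
  then show ?thesis using meas by simp
qed

lemma exists_lower_halfspace_measure:
  fixes \<mu> :: "(real ^ 'd) measure"
  assumes \<mu>: "nice_measure \<mu>" and S: "S \<in> sets borel" and u: "u \<noteq> 0"
    and v: "0 < v" "v < measure \<mu> S"
  shows "\<exists>t. measure \<mu> (S \<inter> lower_halfspace u t) = v"
proof -
  interpret finite_measure \<mu> using \<mu> by (rule finite_nice_measure)
  have sets: "sets \<mu> = sets borel" using \<mu> by (rule sets_nice_measure)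
  define F where "F t = measure \<mu> (S \<inter> lower_halfspace u t)" for t
  have meas: "S \<inter> lower_halfspace u t \<in> sets \<mu>" for t
    using S by (simp add: sets borel_open open_lower_halfspace)
  have cont: "continuous_on UNIV F"
    unfolding continuous_on_sequentially F_def comp_def
    using tendsto_measure_lower_halfspace[OF \<mu> S u tendsto_const] by blast
  have "(\<lambda>n. F (real n)) \<longlonglongrightarrow> measure \<mu> (\<Union>n. S \<inter> lower_halfspace u (real n))"
    unfolding F_def using meas
    by (intro finite_Lim_measure_incseq) (auto simp: incseq_def lower_halfspace_simps)
  moreover have "(\<Union>n. S \<inter> lower_halfspace u (real n)) = S"
    by (auto simp: lower_halfspace_simps reals_Archimedean2)
  ultimately have "(\<lambda>n. F (real n)) \<longlonglongrightarrow> measure \<mu> S" by simp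
  from order_tendstoD(1)[OF this v(2)] obtain n where n: "F (real n) > v"
    by (auto simp: eventually_sequentially)
  have "(\<lambda>n. F (- real n)) \<longlonglongrightarrow> measure \<mu> (\<Inter>n. S \<inter> lower_halfspace u (- real n))"
    unfolding F_def using meas
    by (intro finite_Lim_measure_decseq) (auto simp: decseq_def lower_halfspace_simps)
  moreover have "(\<Inter>n. S \<inter> lower_halfspace u (- real n)) = {}"
  proof -
    have "\<exists>n. x \<notin> lower_halfspace u (- real n)" for x
    proof -
      obtain n where "- (u \<bullet> x) < real n" using reals_Archimedean2 by blast
      then have "x \<notin> lower_halfspace u (- real n)" by (simp add: lower_halfspace_simps)
      then show ?thesis by blast
    qed
    then show ?thesis by blast
  qed
  ultimately have "(\<lambda>n. F (- real n)) \<longlonglongrightarrow> 0" by simp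
  from order_tendstoD(2)[OF this v(1)] obtain m where m: "F (- real m) < v"
    by (auto simp: eventually_sequentially)
  have "\<exists>t\<ge>- real m. t \<le> real n \<and> F t = v"
    using m n cont by (intro IVT') (auto intro: continuous_on_subset)
  then show ?thesis unfolding F_def by blast
qed

text \<open>Convexity of \<open>S\<close> is essential here: it makes \<open>S\<close> meet the slab between the two hyperplanes. This
  is what makes the offset in \<open>exists_lower_halfspace_measure\<close> unique and continuous in the normal.\<close>

lemma measure_lower_halfspace_strict_mono:
  fixes \<mu> :: "(real ^ 'd) measure"
  assumes \<mu>: "nice_measure \<mu>" and S: "open S" "convex S" and u: "u \<noteq> 0" and "s < t"
    and pos: "measure \<mu> (S \<inter> lower_halfspace u t) > 0"
    and less: "measure \<mu> (S \<inter> lower_halfspace u s) < measure \<mu> S"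
  shows "measure \<mu> (S \<inter> lower_halfspace u s) < measure \<mu> (S \<inter> lower_halfspace u t)"
proof -
  interpret finite_measure \<mu> using \<mu> by (rule finite_nice_measure)
  have sets: "sets \<mu> = sets borel" using \<mu> by (rule sets_nice_measure)
  have meas: "S \<inter> lower_halfspace u t \<in> sets \<mu>" for t
    using S by (simp add: sets borel_open open_lower_halfspace open_Int)
  have "S \<inter> lower_halfspace u t \<noteq> {}" using pos by auto
  then obtain p where p: "p \<in> S" "u \<bullet> p < t" by (auto simp: lower_halfspace_simps)
  have "\<not> S \<subseteq> lower_halfspace u s" using less by (auto simp: Int_absorb2)
  \<comment> \<open>An open set inside the closed half-space lies in its interior.\<close>
  then have "\<not> S \<subseteq> {x. u \<bullet> x \<le> s}"
    using interior_maximal[OF _ S(1), of "{x. u \<bullet> x \<le> s}"]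
    by (auto simp: interior_halfspace_le[OF u] lower_halfspace_def)
  then obtain q where q: "q \<in> S" "s < u \<bullet> q"
    unfolding subset_iff mem_Collect_eq not_le by force
  define W where "W = S \<inter> {x. s < u \<bullet> x} \<inter> {x. u \<bullet> x < t}"
  have "open W"
    unfolding W_def by (intro open_Int S open_halfspace_gt open_halfspace_lt)
  have "W \<noteq> {}"
  proof (cases "u \<bullet> p > s \<or> u \<bullet> q < t")
    case True
    then show ?thesis using p q by (auto simp: W_def)
  next
    case False
    define r where "r = (s + t) / 2"
    have r: "s < r" "r < t" using \<open>s < t\<close> by (auto simp: r_def)
    then obtain z where "z \<in> S" "u \<bullet> z = r"
      using connected_ivt_hyperplane[OF convex_connected[OF S(2)] p(1) q(1), of u r] False by auto
    then show ?thesis using r by (auto simp: W_def)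
  qed
  then have "measure \<mu> W > 0" using nice_measure_open_pos[OF \<mu> \<open>open W\<close>] by blast
  moreover have "measure \<mu> ((S \<inter> lower_halfspace u s) \<union> W) = measure \<mu> (S \<inter> lower_halfspace u s) + measure \<mu> W"
    using meas \<open>open W\<close> by (intro finite_measure_Union) (auto simp: sets W_def lower_halfspace_simps)
  moreover have "measure \<mu> ((S \<inter> lower_halfspace u s) \<union> W) \<le> measure \<mu> (S \<inter> lower_halfspace u t)"
    using meas \<open>s < t\<close> by (intro finite_measure_mono) (auto simp: W_def lower_halfspace_simps)
  ultimately show ?thesis by linarith
qed

lemma measure_upper_halfspace:
  fixes \<mu> :: "(real ^ 'd) measure"
  assumes \<mu>: "nice_measure \<mu>" and S: "S \<in> sets borel" and u: "u \<noteq> 0"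
  shows "measure \<mu> (S \<inter> {x. u \<bullet> x > t}) = measure \<mu> S - measure \<mu> (S \<inter> lower_halfspace u t)"
proof -
  interpret finite_measure \<mu> using \<mu> by (rule finite_nice_measure)
  have sets: "sets \<mu> = sets borel" using \<mu> by (rule sets_nice_measure)
  have null: "{x. u \<bullet> x = t} \<in> null_sets \<mu>"
    using nice_measure_null_sets[OF \<mu>] negligible_hyperplane[of u t] u
    by (simp add: borel_closed closed_hyperplane)
  have meas: "S \<inter> lower_halfspace u t \<in> sets \<mu>" "S \<in> sets \<mu>"
    using S by (simp_all add: sets borel_open open_lower_halfspace)
  have "S - S \<inter> lower_halfspace u t - {x. u \<bullet> x = t} = S \<inter> {x. u \<bullet> x > t}"
    by (auto simp: lower_halfspace_simps)
  then have "measure \<mu> (S \<inter> {x. u \<bullet> x > t}) = measure \<mu> (S - S \<inter> lower_halfspace u t)"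
    using measure_Diff_null_set[OF _ null, of "S - S \<inter> lower_halfspace u t"] meas by simp
  also have "\<dots> = measure \<mu> S - measure \<mu> (S \<inter> lower_halfspace u t)"
    using meas by (intro finite_measure_Diff) auto
  finally show ?thesis .
qed

section \<open>Cutting two separated sets at once\<close>

lemma separated_ham_sandwich:
  fixes \<mu> :: "(real ^ 'd) measure"
  assumes \<mu>: "nice_measure \<mu>" and dim: "2 \<le> CARD('d)"
    and A: "open A" "convex A" and B: "open B"
    and sep: "w \<noteq> 0" "A \<subseteq> {x. w \<bullet> x < s}" "B \<subseteq> {x. w \<bullet> x > s}"
    and a: "0 < a" "a < measure \<mu> A" and b: "0 \<le> b" "b \<le> measure \<mu> B"
  shows "\<exists>u t. u \<noteq> 0 \<and> measure \<mu> (A \<inter> lower_halfspace u t) = a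
           \<and> measure \<mu> (B \<inter> lower_halfspace u t) = b"
proof -
  define F where "F u t = measure \<mu> (A \<inter> lower_halfspace u t)" for u t
  define G where "G u t = measure \<mu> (B \<inter> lower_halfspace u t)" for u t
  have "\<exists>t. F u t = a" if "u \<noteq> 0" for u
    using exists_lower_halfspace_measure[OF \<mu> _ that a] A unfolding F_def by auto
  then obtain T where T: "\<And>u. u \<noteq> 0 \<Longrightarrow> F u (T u) = a" by metis
  \<comment> \<open>The offset depends continuously on the normal: by strict monotonicity, an offset \<open>r\<close> different from
     \<open>T u\<close> cuts off a measure different from \<open>a\<close> at \<open>u\<close>, hence also at all nearby normals.\<close>
  have T_lim: "(\<lambda>n. T (U n)) \<longlonglongrightarrow> T u" if lim: "U \<longlonglongrightarrow> u" and nz: "u \<noteq> 0" "\<And>n. U n \<noteq> 0" for U u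
  proof (rule order_tendstoI)
    have mono: "F u s < F u t" if "u \<noteq> 0" "s < t" "F u s < measure \<mu> A" "F u t > 0" for u s t
      using measure_lower_halfspace_strict_mono[OF \<mu> A] that unfolding F_def by blast
    have le: "F u s \<le> F u t" if "s \<le> t" for u s t
    proof -
      interpret finite_measure \<mu> using \<mu> by (rule finite_nice_measure)
      show ?thesis unfolding F_def using that A
        by (intro finite_measure_mono)
          (auto simp: lower_halfspace_simps sets_nice_measure[OF \<mu>] open_lower_halfspace open_Int)
    qed
    have lim_F: "(\<lambda>n. F (U n) t) \<longlonglongrightarrow> F u t" for t
      unfolding F_def using A by (intro tendsto_measure_lower_halfspace[OF \<mu> _ nz(1) lim]) auto
    show "\<forall>\<^sub>F n in sequentially. T (U n) > r" if "r < T u" for r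
    proof -
      have "F u r < a"
        using le[of r "T u" u] mono[OF nz(1) that] a T[OF nz(1)] that by force
      from order_tendstoD(2)[OF lim_F this] show ?thesis
      proof (rule eventually_mono)
        fix n assume "F (U n) r < a"
        then show "r < T (U n)" using le[of "T (U n)" r "U n"] T[OF nz(2)] by force
      qed
    qed
    show "\<forall>\<^sub>F n in sequentially. T (U n) < r" if "T u < r" for r
    proof -
      have "F u r > a"
        using le[of "T u" r u] mono[OF nz(1) that] a T[OF nz(1)] that by force
      from order_tendstoD(1)[OF lim_F this] show ?thesis
      proof (rule eventually_mono)
        fix n assume "a < F (U n) r"
        then show "T (U n) < r" using le[of r "T (U n)" "U n"] T[OF nz(2)] by force
      qed
    qed
  qed
  define g where "g u = G u (T u)" for u
  have cont: "continuous_on (sphere 0 1) g"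
    unfolding continuous_on_sequentially
  proof (intro allI ballI impI, elim conjE)
    fix U u assume U: "\<forall>n. U n \<in> sphere 0 1" and lim: "U \<longlonglongrightarrow> u" and u: "u \<in> sphere (0 :: real ^ 'd) 1"
    have "U n \<noteq> 0" for n using spec[OF U, of n] by auto
    moreover have "u \<noteq> 0" using u by auto
    ultimately have nz: "u \<noteq> 0" "\<And>n. U n \<noteq> 0" by simp_all
    show "(g \<circ> U) \<longlonglongrightarrow> g u"
      unfolding g_def G_def comp_def using B
      by (intro tendsto_measure_lower_halfspace[OF \<mu> _ nz(1) lim T_lim[OF lim nz]]) auto
  qed
  define e where "e = w /\<^sub>R norm w"
  have e: "e \<in> sphere 0 1" "- e \<in> sphere 0 1" "e \<noteq> 0" "- e \<noteq> 0"
    using sep(1) by (auto simp: e_def)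
  define s' where "s' = s / norm w"
  have A': "e \<bullet> x < s'" if "x \<in> A" for x
    using that sep by (auto simp: e_def s'_def field_simps)
  have B': "e \<bullet> x > s'" if "x \<in> B" for x
    using that sep by (auto simp: e_def s'_def field_simps)
  \<comment> \<open>The cut for the normal \<open>e\<close> passes through \<open>A\<close>, so it has all of \<open>B\<close> above it, and that for
     \<open>-e\<close> has all of \<open>B\<close> below it.\<close>
  have "g e = 0"
  proof -
    have "T e < s'"
    proof (rule ccontr)
      assume "\<not> T e < s'"
      then have "A \<inter> lower_halfspace e (T e) = A" using A' by (force simp: lower_halfspace_simps)
      then show False using T[OF e(3)] a by (simp add: F_def)
    qed
    then have "B \<inter> lower_halfspace e (T e) = {}" using B' by (force simp: lower_halfspace_simps)
    then show ?thesis by (simp add: g_def G_def)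
  qed
  moreover have "g (- e) = measure \<mu> B"
  proof -
    have "- T (- e) < s'"
    proof (rule ccontr)
      assume "\<not> - T (- e) < s'"
      then have "A \<inter> lower_halfspace (- e) (T (- e)) = {}" using A' by (force simp: lower_halfspace_simps)
      then show False using T[OF e(4)] a by (simp add: F_def)
    qed
    then have "B \<inter> lower_halfspace (- e) (T (- e)) = B" using B' by (force simp: lower_halfspace_simps)
    then show ?thesis by (simp add: g_def G_def)
  qed
  moreover have "connected (g ` sphere 0 1)"
    using dim by (intro connected_continuous_image[OF cont] connected_sphere) simp
  ultimately have "b \<in> g ` sphere 0 1"
    using b imageI[OF e(1), of g] imageI[OF e(2), of g]
      connectedD_interval[of "g ` sphere 0 1" "g e" "g (- e)" b] by simp
  then obtain u where u: "norm u = 1" "g u = b" by auto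
  then have "u \<noteq> 0" by auto
  with T[OF this] u show ?thesis unfolding F_def G_def g_def by blast
qed

section \<open>Lines in the plane\<close>

text \<open>If two lines share two points, the first is contained in the second.\<close>

lemma lines_meet_twice_eq:
  fixes a u p q x :: "real ^ 2"
  assumes "a \<noteq> 0" "p \<noteq> q"
    and "a \<bullet> p = b" "a \<bullet> q = b" "u \<bullet> p = t" "u \<bullet> q = t" "a \<bullet> x = b"
  shows "u \<bullet> x = t"
proof -
  define d y where "d = q - p" and "y = x - p"
  have d: "d \<noteq> 0" and ad: "a \<bullet> d = 0" and ud: "u \<bullet> d = 0" and ay: "a \<bullet> y = 0"
    using assms by (auto simp: d_def y_def inner_diff_right)
  have det: "d$1 * y$2 = d$2 * y$1"
  proof -
    have 1: "a$1 * d$1 + a$2 * d$2 = 0" "a$1 * y$1 + a$2 * y$2 = 0"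
      using ad ay by (auto simp: inner_vec_def sum_2)
    have "a$1 * (d$1 * y$2 - d$2 * y$1) = 0" "a$2 * (d$1 * y$2 - d$2 * y$1) = 0"
      using 1 by algebra+
    moreover have "a$1 \<noteq> 0 \<or> a$2 \<noteq> 0" using \<open>a \<noteq> 0\<close> by (auto simp: vec_eq_iff forall_2)
    ultimately show ?thesis by auto
  qed
  have u1: "u$1 * d$1 + u$2 * d$2 = 0" using ud by (auto simp: inner_vec_def sum_2)
  have "d$1 * (u$1 * y$1 + u$2 * y$2) = 0" "d$2 * (u$1 * y$1 + u$2 * y$2) = 0"
    using det u1 by algebra+
  moreover have "d$1 \<noteq> 0 \<or> d$2 \<noteq> 0" using d by (auto simp: vec_eq_iff forall_2)
  ultimately have "u \<bullet> y = 0" by (auto simp: inner_vec_def sum_2)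
  then show ?thesis using assms by (simp add: y_def inner_diff_right)
qed

text \<open>A line \<open>l\<close> meeting all four pieces would cross the cutting line \<open>u \<bullet> x = t\<close> once in \<open>A\<close> and once
  in \<open>B\<close>, hence coincide with it; but the pieces lie off the cutting line.\<close>

lemma line_meets_at_most_three_pieces:
  fixes A B :: "(real ^ 2) set"
  assumes "convex A" "convex B" "A \<inter> B = {}" and a: "a \<noteq> 0"
    and AB: "A\<^sub>1 \<subseteq> A \<inter> {x. u \<bullet> x < t}" "A\<^sub>2 \<subseteq> A \<inter> {x. u \<bullet> x > t}"
      "B\<^sub>1 \<subseteq> B \<inter> {x. u \<bullet> x < t}" "B\<^sub>2 \<subseteq> B \<inter> {x. u \<bullet> x > t}"
    and l: "l = {x. a \<bullet> x = b}"
  shows "\<exists>C\<in>{A\<^sub>1, A\<^sub>2, B\<^sub>1, B\<^sub>2}. l \<inter> C = {}"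
proof (rule ccontr)
  assume "\<not> ?thesis"
  then have "l \<inter> A\<^sub>1 \<noteq> {}" "l \<inter> A\<^sub>2 \<noteq> {}" "l \<inter> B\<^sub>1 \<noteq> {}" "l \<inter> B\<^sub>2 \<noteq> {}"
    by simp_all
  then obtain p\<^sub>1 p\<^sub>2 q\<^sub>1 q\<^sub>2
    where pq: "p\<^sub>1 \<in> l \<inter> A\<^sub>1" "p\<^sub>2 \<in> l \<inter> A\<^sub>2" "q\<^sub>1 \<in> l \<inter> B\<^sub>1" "q\<^sub>2 \<in> l \<inter> B\<^sub>2"
    unfolding ex_in_conv[symmetric] by (elim exE)
  from pq AB have in_parts: "p\<^sub>1 \<in> l \<inter> A" "p\<^sub>2 \<in> l \<inter> A" "q\<^sub>1 \<in> l \<inter> B" "q\<^sub>2 \<in> l \<inter> B"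
    and sides: "u \<bullet> p\<^sub>1 < t" "u \<bullet> p\<^sub>2 > t" "u \<bullet> q\<^sub>1 < t" "u \<bullet> q\<^sub>2 > t"
    by auto
  have meet: "\<exists>z\<in>l \<inter> C. u \<bullet> z = t"
    if "convex C" "x \<in> l \<inter> C" "y \<in> l \<inter> C" "u \<bullet> x < t" "u \<bullet> y > t" for C x y
  proof -
    have "convex (l \<inter> C)" unfolding l by (intro convex_Int convex_hyperplane that)
    then show ?thesis
      using connected_ivt_hyperplane[OF convex_connected, of "l \<inter> C" x y u t] that by auto
  qed
  obtain p where p: "p \<in> l \<inter> A" "u \<bullet> p = t" using meet[OF assms(1) in_parts(1,2) sides(1,2)] by blast
  obtain q where q: "q \<in> l \<inter> B" "u \<bullet> q = t" using meet[OF assms(2) in_parts(3,4) sides(3,4)] by blast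
  have "u \<bullet> p\<^sub>1 = t"
    by (rule lines_meet_twice_eq[OF a, of p q b]) (use p q in_parts(1) assms(3) in \<open>auto simp: l\<close>)
  then show False using sides by simp
qed

section \<open>The partition\<close>

text \<open>The index \<open>i\<close> counts the cuts still to be made. With \<open>i = 0\<close> both sets are final parts of measure
  \<open>c\<close>; otherwise they have measures \<open>2 * c\<close> and \<open>2 * i * c\<close>. The two \<open>of_bool\<close> terms in the bound make
  the induction work: a line that misses one of the two sets does not cross the boundary between
  them, and the bound on the number of parts that it meets drops by one.\<close>

lemma separated_pair_partition:
  fixes \<mu> :: "(real ^ 2) measure"
  assumes \<mu>: "nice_measure \<mu>" and c: "c > 0"
    and "open A" "convex A" "open B" "convex B"
    and "w \<noteq> 0" "A \<subseteq> {x. w \<bullet> x < s}" "B \<subseteq> {x. w \<bullet> x > s}"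
    and "measure \<mu> A = (if i = 0 then c else 2 * c)"
    and "measure \<mu> B = (if i = 0 then c else 2 * real i * c)"
  shows "\<exists>P. finite P \<and> card P = 2 * i + 2 \<and> pairwise disjnt P \<and>
           (\<forall>C\<in>P. open C \<and> convex C \<and> measure \<mu> C = c \<and> (C \<subseteq> A \<or> C \<subseteq> B)) \<and>
           (\<forall>l. hyperplane l \<longrightarrow>
              card {C\<in>P. l \<inter> C \<noteq> {}} \<le> i + of_bool (l \<inter> A \<noteq> {}) + of_bool (l \<inter> B \<noteq> {}))"
  using assms(3-)
proof (induction i arbitrary: A B w s)
  case 0
  have AB: "A \<inter> B = {}" using "0.prems" by fastforce
  have ne: "A \<noteq> {}" "B \<noteq> {}" using "0.prems" c by auto
  with AB have "A \<noteq> B" by auto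
  have "card {C\<in>{A, B}. l \<inter> C \<noteq> {}} \<le> 0 + of_bool (l \<inter> A \<noteq> {}) + of_bool (l \<inter> B \<noteq> {})" for l
  proof -
    have "{C\<in>{A, B}. l \<inter> C \<noteq> {}} = (if l \<inter> A \<noteq> {} then {A} else {}) \<union> (if l \<inter> B \<noteq> {} then {B} else {})"
      by auto
    then show ?thesis by (simp add: card_insert_if)
  qed
  then show ?case
    using "0.prems" AB \<open>A \<noteq> B\<close>
    by (intro exI[of _ "{A, B}"]) (auto simp: pairwise_def disjnt_def)
next
  case (Suc i)
  note prems = Suc.prems
  have AB: "A \<inter> B = {}" using prems by fastforce
  define b where "b = (if i = 0 then c else 2 * c)"
  have "2 * c \<le> 2 * real (Suc i) * c" using c by simp
  then have "0 \<le> b" "b \<le> measure \<mu> B"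
    using c prems unfolding b_def by auto
  then obtain u t where u: "u \<noteq> 0" and halves: "measure \<mu> (A \<inter> lower_halfspace u t) = c"
      "measure \<mu> (B \<inter> lower_halfspace u t) = b"
    using separated_ham_sandwich[OF \<mu> _ prems(1,2,3) prems(5-7), of c b] c prems by auto
  define A\<^sub>1 A\<^sub>2 where "A\<^sub>1 = A \<inter> lower_halfspace u t" and "A\<^sub>2 = A \<inter> {x. u \<bullet> x > t}"
  define B\<^sub>1 B\<^sub>2 where "B\<^sub>1 = B \<inter> lower_halfspace u t" and "B\<^sub>2 = B \<inter> {x. u \<bullet> x > t}"
  have oc: "open A\<^sub>1" "convex A\<^sub>1" "open A\<^sub>2" "convex A\<^sub>2" "open B\<^sub>1" "convex B\<^sub>1" "open B\<^sub>2" "convex B\<^sub>2"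
    unfolding A\<^sub>1_def A\<^sub>2_def B\<^sub>1_def B\<^sub>2_def
    by (simp_all add: prems open_Int convex_Int open_lower_halfspace convex_lower_halfspace
        open_halfspace_gt convex_halfspace_gt)
  have mA: "measure \<mu> A\<^sub>1 = c" "measure \<mu> A\<^sub>2 = c" and mB\<^sub>1: "measure \<mu> B\<^sub>1 = b"
    using halves prems measure_upper_halfspace[OF \<mu> _ u, of A t] by (auto simp: A\<^sub>1_def A\<^sub>2_def B\<^sub>1_def)
  have mB\<^sub>2: "measure \<mu> B\<^sub>2 = (if i = 0 then c else 2 * real i * c)"
    using halves prems measure_upper_halfspace[OF \<mu> _ u, of B t]
    by (auto simp: B\<^sub>2_def b_def algebra_simps)
  have "B\<^sub>1 \<subseteq> {x. u \<bullet> x < t}" "B\<^sub>2 \<subseteq> {x. u \<bullet> x > t}"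
    by (auto simp: B\<^sub>1_def B\<^sub>2_def lower_halfspace_simps)
  from Suc.IH[OF oc(5-8) u this mB\<^sub>1[unfolded b_def] mB\<^sub>2] obtain P
    where P: "finite P" "card P = 2 * i + 2" "pairwise disjnt P"
      "\<And>C. C \<in> P \<Longrightarrow> open C \<and> convex C \<and> measure \<mu> C = c \<and> (C \<subseteq> B\<^sub>1 \<or> C \<subseteq> B\<^sub>2)"
      "\<And>l. hyperplane l \<Longrightarrow>
         card {C\<in>P. l \<inter> C \<noteq> {}} \<le> i + of_bool (l \<inter> B\<^sub>1 \<noteq> {}) + of_bool (l \<inter> B\<^sub>2 \<noteq> {})"
    by blast
  have PB: "C \<subseteq> B" if "C \<in> P" for C
    using P(4)[OF that] by (auto simp: B\<^sub>1_def B\<^sub>2_def)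
  have ne: "A\<^sub>1 \<noteq> {}" "A\<^sub>2 \<noteq> {}" using mA c by auto
  have disj: "A\<^sub>1 \<inter> A\<^sub>2 = {}" by (auto simp: A\<^sub>1_def A\<^sub>2_def lower_halfspace_simps)
  have AP: "A\<^sub>1 \<inter> C = {}" "A\<^sub>2 \<inter> C = {}" "C \<inter> A\<^sub>1 = {}" "C \<inter> A\<^sub>2 = {}" if "C \<in> P" for C
    using PB[OF that] AB by (auto simp: A\<^sub>1_def A\<^sub>2_def)
  have notin: "A\<^sub>1 \<noteq> A\<^sub>2" "A\<^sub>1 \<notin> P" "A\<^sub>2 \<notin> P"
    using ne disj AP by blast+
  define Q where "Q = insert A\<^sub>1 (insert A\<^sub>2 P)"
  have "finite Q" "card Q = 2 * Suc i + 2" using P(1,2) notin by (auto simp: Q_def)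
  moreover have "pairwise disjnt Q"
  proof -
    have "disjnt A\<^sub>1 A\<^sub>2" "disjnt A\<^sub>2 A\<^sub>1" using disj by (auto simp: disjnt_def)
    moreover have "\<forall>C\<in>P. disjnt A\<^sub>1 C \<and> disjnt C A\<^sub>1 \<and> disjnt A\<^sub>2 C \<and> disjnt C A\<^sub>2"
      using AP by (simp add: disjnt_def)
    ultimately show ?thesis unfolding Q_def pairwise_insert using P(3) by blast
  qed
  moreover have "open C \<and> convex C \<and> measure \<mu> C = c \<and> (C \<subseteq> A \<or> C \<subseteq> B)" if "C \<in> Q" for C
  proof -
    consider "C = A\<^sub>1" | "C = A\<^sub>2" | "C \<in> P" using \<open>C \<in> Q\<close> unfolding Q_def by blast
    then show ?thesis
    proof cases
      case 3
      then show ?thesis using P(4) PB by blast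
    qed (use oc mA in \<open>auto simp: A\<^sub>1_def A\<^sub>2_def\<close>)
  qed
  moreover have "card {C\<in>Q. l \<inter> C \<noteq> {}} \<le> Suc i + of_bool (l \<inter> A \<noteq> {}) + of_bool (l \<inter> B \<noteq> {})"
    if l: "hyperplane l" for l
  proof -
    \<comment> \<open>Among the four pieces made by the current cut, \<open>l\<close> meets at most one more than it meets among
       \<open>A\<close> and \<open>B\<close>.\<close>
    let ?meets = "\<lambda>C. of_bool (l \<inter> C \<noteq> {}) :: nat"
    have "{C\<in>Q. l \<inter> C \<noteq> {}} =
        (if l \<inter> A\<^sub>1 \<noteq> {} then {A\<^sub>1} else {}) \<union> (if l \<inter> A\<^sub>2 \<noteq> {} then {A\<^sub>2} else {}) \<union> {C\<in>P. l \<inter> C \<noteq> {}}"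
      by (auto simp: Q_def)
    then have "card {C\<in>Q. l \<inter> C \<noteq> {}} \<le> ?meets A\<^sub>1 + ?meets A\<^sub>2 + card {C\<in>P. l \<inter> C \<noteq> {}}"
      using P(1) by (auto simp: card_insert_if)
    also have "\<dots> \<le> i + (?meets A\<^sub>1 + ?meets A\<^sub>2 + ?meets B\<^sub>1 + ?meets B\<^sub>2)"
      using P(5)[OF l] by simp
    also have "?meets A\<^sub>1 + ?meets A\<^sub>2 + ?meets B\<^sub>1 + ?meets B\<^sub>2 \<le> 1 + ?meets A + ?meets B"
    proof -
      have mono: "?meets C \<le> ?meets D" if "C \<subseteq> D" for C D using that by auto
      have "?meets A\<^sub>1 \<le> ?meets A" "?meets A\<^sub>2 \<le> ?meets A" "?meets B\<^sub>1 \<le> ?meets B" "?meets B\<^sub>2 \<le> ?meets B"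
        by (rule mono; auto simp: A\<^sub>1_def A\<^sub>2_def B\<^sub>1_def B\<^sub>2_def)+
      moreover obtain a d where "a \<noteq> 0" "l = {x. a \<bullet> x = d}"
        using l unfolding hyperplane_def by blast
      then have "\<exists>C\<in>{A\<^sub>1, A\<^sub>2, B\<^sub>1, B\<^sub>2}. l \<inter> C = {}"
        by (intro line_meets_at_most_three_pieces[OF prems(2) prems(4) AB, of a _ u t])
          (auto simp: A\<^sub>1_def A\<^sub>2_def B\<^sub>1_def B\<^sub>2_def lower_halfspace_simps)
      then have "?meets A\<^sub>1 = 0 \<or> ?meets A\<^sub>2 = 0 \<or> ?meets B\<^sub>1 = 0 \<or> ?meets B\<^sub>2 = 0"
        by auto
      moreover have "?meets A \<le> 1" "?meets B \<le> 1" by simp_all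
      ultimately show ?thesis by linarith
    qed
    finally show ?thesis by simp
  qed
  ultimately show ?case by blast
qed

text \<open>An open convex set is the interior of its closure and has a null frontier. The complement of the
  union of the closures is open and, by the assumption on the total measure, null; hence it is empty.\<close>

lemma nice_measure_partition_closures:
  fixes \<mu> :: "(real ^ 'd) measure"
  assumes \<mu>: "nice_measure \<mu>" and P: "finite P" "pairwise disjnt P"
    and all_parts: "\<forall>C\<in>P. open C \<and> convex C \<and> measure \<mu> C = c"
    and total: "real (card P) * c = measure \<mu> UNIV" and c: "c > 0"
  shows "convex_partition (card P) (closure ` P)"
    and "\<And>C. C \<in> P \<Longrightarrow> interior (closure C) = C"
    and "\<And>C. C \<in> P \<Longrightarrow> measure \<mu> (closure C) = c"
proof -
  interpret finite_measure \<mu> using \<mu> by (rule finite_nice_measure)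
  have sets: "sets \<mu> = sets borel" using \<mu> by (rule sets_nice_measure)
  have parts: "open C \<and> convex C \<and> measure \<mu> C = c" if "C \<in> P" for C
    using all_parts that by blast
  show int: "interior (closure C) = C" if "C \<in> P" for C
    using parts[OF that] convex_interior_closure[of C] by (simp add: interior_open)
  show "measure \<mu> (closure C) = c" if C: "C \<in> P" for C
  proof -
    have "frontier C \<in> null_sets \<mu>"
      using nice_measure_null_sets[OF \<mu>, of "frontier C"] negligible_convex_frontier[of C] parts[OF C]
      by (simp add: borel_closed)
    moreover have "closure C - frontier C = C"
      using int[OF C] parts[OF C] closure_subset[of C] by (auto simp: frontier_def interior_open)
    ultimately show ?thesis
      using measure_Diff_null_set[of "closure C" \<mu> "frontier C"] parts[OF C] by (simp add: sets)
  qed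
  have cover: "\<Union>(closure ` P) = UNIV"
  proof (rule ccontr)
    assume ne: "\<Union>(closure ` P) \<noteq> UNIV"
    define W where "W = - \<Union>(closure ` P)"
    have "open W" unfolding W_def using P(1) by (intro open_Compl closed_UN) auto
    moreover have "W \<noteq> {}" using ne by (auto simp: W_def)
    ultimately have "measure \<mu> W > 0" by (rule nice_measure_open_pos[OF \<mu>])
    have "P \<subseteq> sets borel" using parts by auto
    then have "measure \<mu> (\<Union>P) = (\<Sum>C\<in>P. measure \<mu> C)"
      using finite_measure_finite_Union[of P "\<lambda>C. C"] P
      by (auto simp: sets pairwise_def disjnt_def disjoint_family_on_def)
    also have "\<dots> = measure \<mu> UNIV" using parts total by simp
    finally have "measure \<mu> (\<Union>P) = measure \<mu> UNIV" .
    moreover have "measure \<mu> (\<Union>P \<union> W) = measure \<mu> (\<Union>P) + measure \<mu> W"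
      using parts \<open>open W\<close> closure_subset
      by (intro finite_measure_Union) (auto simp: sets W_def intro!: borel_open open_Union)
    moreover have "measure \<mu> (\<Union>P \<union> W) \<le> measure \<mu> UNIV"
      by (intro finite_measure_mono) (auto simp: sets)
    ultimately show False using \<open>measure \<mu> W > 0\<close> by linarith
  qed
  have "inj_on closure P" using int by (rule inj_on_inverseI)
  then have "card (closure ` P) = card P" by (rule card_image)
  moreover have "C \<noteq> {}" if "C \<in> P" for C using parts[OF that] c by auto
  moreover have "C \<inter> D = {}" if "C \<in> P" "D \<in> P" "closure C \<noteq> closure D" for C D
    using that P(2) unfolding pairwise_def disjnt_def by metis
  ultimately show "convex_partition (card P) (closure ` P)"
    unfolding convex_partition_def using P(1) cover parts int
    by (simp add: convex_closure)
qed

theorem corollary3: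
  fixes k :: nat
  assumes "k > 0"
  shows "N_parts TYPE(2) k \<le> enat (2 * k + 2)"
proof -
  have "\<exists>P. convex_partition (2 * k + 2) P \<and>
          (\<forall>C\<in>P. \<forall>D\<in>P. emeasure \<mu> C = emeasure \<mu> D) \<and>
          (\<forall>H. hyperplane H \<longrightarrow> k \<le> card {C \<in> P. avoids H C})"
    if \<mu>: "nice_measure \<mu>" for \<mu> :: "(real ^ 2) measure"
  proof -
    interpret finite_measure \<mu> using \<mu> by (rule finite_nice_measure)
    define c where "c = measure \<mu> UNIV / real (2 * k + 2)"
    have "measure \<mu> UNIV > 0" using nice_measure_open_pos[OF \<mu>, of UNIV] by simp
    then have c: "c > 0" and total: "measure \<mu> UNIV = (2 * real k + 2) * c"
      by (auto simp: c_def field_simps)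
    obtain w :: "real ^ 2" where w: "w \<noteq> 0" using zero_neq_one by metis
    have "0 < 2 * c" "2 * c < measure \<mu> UNIV" using c \<open>k > 0\<close> by (auto simp: total)
    then obtain s where s: "measure \<mu> (UNIV \<inter> lower_halfspace w s) = 2 * c"
      using exists_lower_halfspace_measure[OF \<mu> _ w, of UNIV "2 * c"] by auto
    define A B where "A = lower_halfspace w s" and "B = {x. w \<bullet> x > s}"
    have mA: "measure \<mu> A = (if k = 0 then c else 2 * c)"
      using s \<open>k > 0\<close> by (simp add: A_def)
    have mB: "measure \<mu> B = (if k = 0 then c else 2 * real k * c)"
      using measure_upper_halfspace[OF \<mu> _ w, of UNIV s] s total \<open>k > 0\<close>
      by (simp add: B_def algebra_simps)
    have AB: "open A" "convex A" "open B" "convex B" "A \<subseteq> {x. w \<bullet> x < s}" "B \<subseteq> {x. w \<bullet> x > s}"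
      by (auto simp: A_def B_def open_lower_halfspace convex_lower_halfspace lower_halfspace_simps
          open_halfspace_gt convex_halfspace_gt)
    from separated_pair_partition[OF \<mu> c AB(1-4) w AB(5,6) mA mB] obtain P
      where P: "finite P" "card P = 2 * k + 2" "pairwise disjnt P"
        "\<forall>C\<in>P. open C \<and> convex C \<and> measure \<mu> C = c"
        "\<And>l. hyperplane l \<Longrightarrow>
           card {C\<in>P. l \<inter> C \<noteq> {}} \<le> k + of_bool (l \<inter> A \<noteq> {}) + of_bool (l \<inter> B \<noteq> {})"
      by blast
    have "real (card P) * c = measure \<mu> UNIV" using P(2) total by simp
    note Q = nice_measure_partition_closures[OF \<mu> P(1,3,4) this c]
    have inj: "inj_on closure P" using Q(2) by (rule inj_on_inverseI)
    have "emeasure \<mu> (closure C) = ennreal c" if "C \<in> P" for C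
      using Q(3)[OF that] by (simp add: emeasure_eq_measure)
    moreover have "k \<le> card {C \<in> closure ` P. avoids H C}" if H: "hyperplane H" for H
    proof -
      have "card {C\<in>P. H \<inter> C \<noteq> {}} \<le> k + 2"
        using P(5)[OF H] by (auto simp: of_bool_def split: if_splits)
      moreover have "card P = card {C\<in>P. H \<inter> C \<noteq> {}} + card {C\<in>P. H \<inter> C = {}}"
        using P(1) by (subst card_Un_disjoint[symmetric]) (auto intro!: arg_cong[where f = card])
      moreover have "{C \<in> closure ` P. avoids H C} = closure ` {C\<in>P. H \<inter> C = {}}"
        using Q(2) by (auto simp: avoids_def)
      moreover have "card (closure ` {C\<in>P. H \<inter> C = {}}) = card {C\<in>P. H \<inter> C = {}}"
        using inj by (intro card_image) (auto intro: inj_on_subset)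
      ultimately show ?thesis using P(2) by simp
    qed
    ultimately show ?thesis
      using Q(1) P(2) by (intro exI[of _ "closure ` P"]) auto
  qed
  then show ?thesis
    unfolding N_parts_def by (intro Inf_lower imageI) auto
qed

end
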